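(* Let $\varphi \colon \mathbb{C}_\ast \to \mathbb{C}_\ast$ be a conjugating mapping. Then $\varphi$ is biholomorphic or anti-biholomorphic.
   Context: $\mathbb{C}_\ast = \mathbb{C}\setminus\{0\}$. For a complex manifold $X$, $\operatorname{End}(X)$ denotes the monoid (under composition) of all holomorphic self-mappings $X \to X$. A set-theoretic mapping $\varphi \colon X \to Y$ between complex manifolds is called a conjugating mapping if it is bijective and if conjugation $f \mapsto \varphi \circ f \circ \varphi^{-1}$ induces a homomorphism $\operatorname{End}(X) \to \operatorname{End}(Y)$, i.e. $\varphi\circ f\circ\varphi^{-1}$ is a holomorphic self-mapping of $Y$ for every $f \in \operatorname{End}(X)$. (No continuity of $\varphi$ is assumed, and the induced homomorphism is not required to be surjective.) *)

theory Defs
  imports "HOL-Complex_Analysis.Complex_Analysis"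
begin

text \<open>
  The complex manifolds in play are open subsets \<^term>\<open>X\<close> of the complex plane. A map on
  \<^term>\<open>X\<close> is a total function of which only the values on \<^term>\<open>X\<close> matter: every notion
  below is invariant under changing the functions outside their domain.
\<close>

definition punctured_plane :: "complex set" where
  "punctured_plane = UNIV - {0}"

definition holomorphic_End :: "complex set \<Rightarrow> (complex \<Rightarrow> complex) set" where
  "holomorphic_End X = {f. f holomorphic_on X \<and> f ` X \<subseteq> X}"

text \<open>
  No continuity of \<^term>\<open>\<phi>\<close> is required. Conjugation by a bijection automatically preserves
  composition and the identity, so it is a homomorphism of endomorphism monoids as soon as
  it maps into the second one; surjectivity of this homomorphism is not required.
\<close>

definition conjugating_map :: "(complex \<Rightarrow> complex) \<Rightarrow> complex set \<Rightarrow> complex set \<Rightarrow> bool" where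
  "conjugating_map \<phi> X Y \<longleftrightarrow>
     bij_betw \<phi> X Y \<and>
     (\<forall>f \<in> holomorphic_End X. \<phi> \<circ> f \<circ> inv_into X \<phi> \<in> holomorphic_End Y)"

definition antiholomorphic_on :: "(complex \<Rightarrow> complex) \<Rightarrow> complex set \<Rightarrow> bool" where
  "antiholomorphic_on f X \<longleftrightarrow> (\<lambda>z. cnj (f z)) holomorphic_on X"

definition biholomorphic_map :: "(complex \<Rightarrow> complex) \<Rightarrow> complex set \<Rightarrow> complex set \<Rightarrow> bool" where
  "biholomorphic_map f X Y \<longleftrightarrow>
     bij_betw f X Y \<and> f holomorphic_on X \<and> inv_into X f holomorphic_on Y"

definition antibiholomorphic_map :: "(complex \<Rightarrow> complex) \<Rightarrow> complex set \<Rightarrow> complex set \<Rightarrow> bool" where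
  "antibiholomorphic_map f X Y \<longleftrightarrow>
     bij_betw f X Y \<and> antiholomorphic_on f X \<and> antiholomorphic_on (inv_into X f) Y"

end

theory Submission
  imports Defs
begin

text \<open>
  Conjugation maps rotations \<open>z \<mapsto> a z\<close> to automorphisms of the punctured plane, and since every
  rotation is the square of another one, to rotations again. Hence, up to a constant factor,
  \<open>\<phi>\<close> is a multiplicative homomorphism. If \<open>G\<close> is the conjugate of \<open>exp\<close>, then \<open>exp ((1 + x) z) = exp z exp (x z)\<close>
  becomes \<open>G (\<phi> (1 + x) w) = G w G (\<phi> x w)\<close>, so that \<open>L w = w G' w / G w\<close> satisfies
  \<open>L (\<phi> (1 + x) w) = L w + L (\<phi> x w)\<close>. The case \<open>x = 1\<close> forces \<open>L\<close> to be a monomial \<open>c w\<^sup>n\<close>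
  (after replacing \<open>\<phi>\<close> by \<open>1 / \<phi>\<close> if necessary), so \<open>\<phi>\<^sup>n\<close> is additive, \<open>n = 1\<close> by injectivity, and
  \<open>\<phi>\<close> is a field automorphism of the complex numbers. If its inverse were unbounded near 0, there would be
  \<open>z\<^sub>k \<rightarrow> \<infinity>\<close> with \<open>\<phi> z\<^sub>k \<rightarrow> 0\<close>; for an entire \<open>W\<close> vanishing exactly at the points \<open>1 + z\<^sub>k\<close>, the
  conjugate of \<open>exp (c W)\<close> would take the value 1 at the points \<open>1 + \<phi> z\<^sub>k\<close>, which accumulate at 1, and
  so be constant. A field automorphism with locally bounded inverse is the identity or complex conjugation.
\<close>

section \<open>Automorphisms of the punctured plane\<close>

lemma holomorphic_compose_inverse:
  assumes "f holomorphic_on -{0::complex}"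
  shows "(\<lambda>z. f (inverse z)) holomorphic_on -{0}"
proof -
  have "(\<lambda>z. inverse z) holomorphic_on -{0::complex}"
    by (intro holomorphic_intros) auto
  from holomorphic_on_compose_gen[OF this assms] have "(f \<circ> inverse) holomorphic_on -{0}"
    by (force simp: image_subset_iff)
  then show ?thesis by (simp add: o_def)
qed

text \<open>Great Picard gives \<open>f\<close> or \<open>1 / f\<close> a finite limit at 0. A
  nonzero finite limit \<open>l\<close> of \<open>f\<close> is impossible: \<open>g\<close> is
  continuous at \<open>l\<close>, so \<open>g l\<close> would be the limit of
  \<open>g (f z) = z\<close>, namely 0.\<close>

lemma biholomorphic_punctured_limit:
  assumes "f holomorphic_on -{0}" "g holomorphic_on -{0}"
    and nz: "\<And>z. z \<noteq> 0 \<Longrightarrow> f z \<noteq> 0" "\<And>z. z \<noteq> 0 \<Longrightarrow> g z \<noteq> 0"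
    and gf: "\<And>z. z \<noteq> 0 \<Longrightarrow> g (f z) = z"
  shows "(f \<longlongrightarrow> 0) (at 0) \<or> ((\<lambda>z. inverse (f z)) \<longlongrightarrow> 0) (at 0)"
proof -
  have no_limit: "l = 0" if "(f \<longlongrightarrow> l) (at 0)" for l
  proof (rule ccontr)
    assume l: "l \<noteq> 0"
    have "isCont g l"
      using assms(2) l by (metis ComplI continuous_on_interior holomorphic_on_imp_continuous_on
          interior_open open_Compl closed_singleton singletonD)
    then have "((\<lambda>z. g (f z)) \<longlongrightarrow> g l) (at 0)"
      using that isCont_tendsto_compose by blast
    moreover have "((\<lambda>z. g (f z)) \<longlongrightarrow> 0) (at 0)"
      by (rule Lim_transform_eventually[OF tendsto_ident_at])
        (auto simp: eventually_at_filter gf)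
    ultimately have "g l = 0"
      using LIM_unique by blast
    then show False using nz(2) l by blast
  qed
  obtain l where l: "(f \<longlongrightarrow> l) (at 0) \<or> ((inverse \<circ> f) \<longlongrightarrow> l) (at 0)"
  \<comment> \<open>The omitted values are 0 and \<open>f 2\<close>; the latter because 2 lies
    outside the unit disc and \<open>f\<close> is injective.\<close>
  proof (rule great_Picard[of "ball 0 1" 0 0 "f 2" f])
    show "f holomorphic_on ball 0 1 - {0}"
      by (rule holomorphic_on_subset[OF assms(1)]) auto
    show "f w \<noteq> 0 \<and> f w \<noteq> f 2" if "w \<in> ball 0 1 - {0}" for w
      using that nz(1)[of w] gf[of w] gf[of 2] by auto
  qed (use nz in auto)
  then show ?thesis
  proof
    assume "(f \<longlongrightarrow> l) (at 0)"
    then show ?thesis using no_limit by blast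
  next
    assume lim: "((inverse \<circ> f) \<longlongrightarrow> l) (at 0)"
    show ?thesis
    proof (cases "l = 0")
      case True
      then show ?thesis using lim by (simp add: o_def)
    next
      case False
      from tendsto_inverse[OF lim False] have "(f \<longlongrightarrow> inverse l) (at 0)"
        by (simp add: o_def)
      from no_limit[OF this] False show ?thesis by simp
    qed
  qed
qed

text \<open>Extending \<open>f\<close> by 0 gives an injective entire function, whose zero at 0 is
  therefore simple; \<open>h\<close> is its difference quotient, with the nonzero derivative as
  value at 0.\<close>

lemma injective_vanishing_factor:
  assumes "f holomorphic_on -{0}" "inj_on f (-{0})"
    and nz: "\<And>z. z \<noteq> 0 \<Longrightarrow> f z \<noteq> 0" and lim: "(f \<longlongrightarrow> 0) (at 0)"
  obtains h where "h holomorphic_on UNIV" "\<And>z. h z \<noteq> 0" "\<And>z. z \<noteq> 0 \<Longrightarrow> f z = z * h z"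
proof -
  define F where "F = (\<lambda>z. if z = 0 then 0 else f z)"
  have F: "F holomorphic_on UNIV"
    unfolding F_def by (rule removable_singularity) (use assms in \<open>auto simp: Compl_eq_Diff_UNIV\<close>)
  have "inj F"
  proof (rule injI)
    show "x = y" if "F x = F y" for x y
      using that nz[of x] nz[of y] inj_onD[OF assms(2), of x y]
      by (auto simp: F_def split: if_splits)
  qed
  then have d: "deriv F 0 \<noteq> 0"
    using holomorphic_injective_imp_regular[OF F] by auto
  define h where "h = (\<lambda>z. if z = 0 then deriv F 0 else (F z - F 0) / (z - 0))"
  show thesis
  proof
    show "h holomorphic_on UNIV"
      unfolding h_def by (rule pole_lemma[OF F]) auto
  qed (use nz d in \<open>auto simp: h_def F_def\<close>)
qed

text \<open>With \<open>f z = z * h z\<close>, the behaviour of \<open>f\<close> at infinity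
  decides. If \<open>f\<close> tends to infinity there, \<open>h\<close> has a finite limit and is
  constant by Liouville; if \<open>f\<close> tends to 0, the entire function \<open>z * h z\<close>
  would vanish identically.\<close>

lemma biholomorphic_vanishing_linear:
  assumes hol: "f holomorphic_on -{0}" "g holomorphic_on -{0}"
    and nz: "\<And>z. z \<noteq> 0 \<Longrightarrow> f z \<noteq> 0" "\<And>z. z \<noteq> 0 \<Longrightarrow> g z \<noteq> 0"
    and gf: "\<And>z. z \<noteq> 0 \<Longrightarrow> g (f z) = z"
    and lim: "(f \<longlongrightarrow> 0) (at 0)"
  obtains c where "c \<noteq> 0" "\<And>z. z \<noteq> 0 \<Longrightarrow> f z = c * z"
proof -
  have inj: "inj_on f (-{0})"
    by (metis ComplD gf inj_onI insertI1)
  obtain h where h: "h holomorphic_on UNIV" "\<And>z. h z \<noteq> 0" "\<And>z. z \<noteq> 0 \<Longrightarrow> f z = z * h z"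
    using injective_vanishing_factor[OF hol(1) inj nz(1) lim] by blast
  \<comment> \<open>This is \<open>f\<close> in the coordinate \<open>1 / z\<close> on both sides;
    the same change turns \<open>g\<close> into a left inverse of \<open>k\<close>, so the dichotomy
    at 0 applies to \<open>k\<close>.\<close>
  define k where "k = (\<lambda>z. inverse (f (inverse z)))"
  have "(\<lambda>z. f (inverse z)) holomorphic_on -{0}"
    by (rule holomorphic_compose_inverse[OF hol(1)])
  then have k: "k holomorphic_on -{0}"
    unfolding k_def by (intro holomorphic_intros) (use nz in auto)
  have ginv: "(\<lambda>z. inverse (g (inverse z))) holomorphic_on -{0}"
  proof (intro holomorphic_intros)
    show "(\<lambda>z. g (inverse z)) holomorphic_on -{0}"
      by (rule holomorphic_compose_inverse[OF hol(2)])
  qed (use nz in auto)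
  have "(k \<longlongrightarrow> 0) (at 0) \<or> ((\<lambda>z. inverse (k z)) \<longlongrightarrow> 0) (at 0)"
    by (rule biholomorphic_punctured_limit[OF k ginv]) (use nz gf in \<open>auto simp: k_def\<close>)
  then show thesis
  proof
    assume k0: "(k \<longlongrightarrow> 0) (at 0)"
    have "inverse (g (inverse (k z))) = z" if "z \<noteq> 0" for z
      using that gf[of "inverse z"] by (simp add: k_def)
    then have "inj_on k (-{0})"
      by (metis ComplD inj_onI singletonI)
    moreover have "k z \<noteq> 0" if "z \<noteq> 0" for z
      using that nz by (simp add: k_def)
    ultimately obtain u where u: "u holomorphic_on UNIV" "\<And>z. u z \<noteq> 0" "\<And>z. z \<noteq> 0 \<Longrightarrow> k z = z * u z"
      using injective_vanishing_factor[OF k _ _ k0] by blast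
    have hu: "h z = inverse (u (inverse z))" if "z \<noteq> 0" for z
    proof -
      have "inverse z * u (inverse z) = inverse (z * h z)"
        using u(3)[of "inverse z"] h(3)[of z] that by (simp add: k_def)
      then show ?thesis using that h(2) u(2) by (simp add: field_simps)
    qed
    have "(u \<longlongrightarrow> u 0) (at 0)"
      using u(1) by (metis UNIV_I continuous_on_def holomorphic_on_imp_continuous_on)
    then have "((\<lambda>z. u (inverse z)) \<longlongrightarrow> u 0) at_infinity"
      by (simp add: lim_at_infinity_0 o_def)
    then have "((\<lambda>z. inverse (u (inverse z))) \<longlongrightarrow> inverse (u 0)) at_infinity"
      using u(2) by (intro tendsto_inverse)
    then have "(h \<longlongrightarrow> inverse (u 0)) at_infinity"
      by (rule Lim_transform_eventually)
        (rule eventually_mono[OF eventually_not_equal_at_infinity[of 0]], simp add: hu)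
    then have "h z = inverse (u 0)" for z
      by (rule Liouville_weak[OF h(1)])
    then show thesis
      using that[of "inverse (u 0)"] h(3) u(2) by (simp add: mult.commute)
  next
    assume "((\<lambda>z. inverse (k z)) \<longlongrightarrow> 0) (at 0)"
    then have "((\<lambda>z. f (inverse z)) \<longlongrightarrow> 0) (at 0)"
      by (simp add: k_def)
    then have f_inf: "(f \<longlongrightarrow> 0) at_infinity"
      by (simp add: lim_at_infinity_0 o_def)
    have "(\<lambda>z. z * h z) holomorphic_on UNIV"
      by (intro holomorphic_intros h)
    moreover have "((\<lambda>z. z * h z) \<longlongrightarrow> 0) at_infinity"
      by (rule Lim_transform_eventually[OF f_inf])
        (rule eventually_mono[OF eventually_not_equal_at_infinity[of 0]], simp add: h(3))
    ultimately have "1 * h 1 = 0"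
      by (rule Liouville_weak)
    then show thesis using h(2) by simp
  qed
qed

text \<open>When \<open>1 / f\<close> is the one that vanishes at 0, the linear case applies to it,
  with left inverse \<open>\<lambda>z. g (inverse z)\<close>.\<close>

lemma biholomorphic_punctured_cases:
  assumes hol: "f holomorphic_on -{0}" "g holomorphic_on -{0}"
    and nz: "\<And>z. z \<noteq> 0 \<Longrightarrow> f z \<noteq> 0" "\<And>z. z \<noteq> 0 \<Longrightarrow> g z \<noteq> 0"
    and gf: "\<And>z. z \<noteq> 0 \<Longrightarrow> g (f z) = z"
  obtains c where "c \<noteq> 0" "(\<forall>z. z \<noteq> 0 \<longrightarrow> f z = c * z) \<or> (\<forall>z. z \<noteq> 0 \<longrightarrow> f z = c / z)"
  using biholomorphic_punctured_limit[OF hol nz gf]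
proof
  assume "(f \<longlongrightarrow> 0) (at 0)"
  from biholomorphic_vanishing_linear[OF hol nz gf this] that show thesis by metis
next
  assume lim: "((\<lambda>z. inverse (f z)) \<longlongrightarrow> 0) (at 0)"
  have f': "(\<lambda>z. inverse (f z)) holomorphic_on -{0}"
    by (intro holomorphic_intros hol) (use nz in auto)
  have g': "(\<lambda>z. g (inverse z)) holomorphic_on -{0}"
    by (rule holomorphic_compose_inverse[OF hol(2)])
  obtain c where c: "c \<noteq> 0" "\<And>z. z \<noteq> 0 \<Longrightarrow> inverse (f z) = c * z"
    by (rule biholomorphic_vanishing_linear[OF f' g' _ _ _ lim]) (use nz gf in auto)
  then have "f z = inverse c / z" if "z \<noteq> 0" for z
    by (metis c(2) divide_inverse inverse_inverse_eq inverse_mult_distrib that)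
  then show thesis using that[of "inverse c"] c(1) by auto
qed

section \<open>The functional equation \<open>L (a z) = 2 L z\<close>\<close>

text \<open>The orbit \<open>a ^ m * z\<close> stays on a circle, where \<open>L\<close> is bounded
  by compactness, while \<open>L\<close> doubles at each step.\<close>

lemma scaling_equation_unit_zero:
  fixes L :: "complex \<Rightarrow> complex"
  assumes L: "L holomorphic_on -{0}" and a: "norm a = 1"
    and eq: "\<And>z. z \<noteq> 0 \<Longrightarrow> L (a * z) = 2 * L z" and z: "z \<noteq> 0"
  shows "L z = 0"
proof (rule ccontr)
  assume Lz: "L z \<noteq> 0"
  have a0: "a \<noteq> 0" using a by auto
  have iter: "L (a ^ m * z) = 2 ^ m * L z" for m
  proof (induction m)
    case (Suc m)
    then show ?case using eq[of "a ^ m * z"] a0 z by (simp add: mult.assoc)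
  qed simp
  have "continuous_on (sphere 0 (norm z)) L"
    by (rule continuous_on_subset[OF holomorphic_on_imp_continuous_on[OF L]]) (use z in auto)
  then have "bounded (L ` sphere 0 (norm z))"
    by (intro compact_imp_bounded compact_continuous_image) auto
  then obtain B where B: "\<And>w. norm w = norm z \<Longrightarrow> norm (L w) \<le> B"
    unfolding bounded_iff by (metis dist_0_norm image_eqI mem_sphere)
  obtain m where m: "B / norm (L z) < 2 ^ m"
    using real_arch_pow[of 2 "B / norm (L z)"] by auto
  have "norm (L (a ^ m * z)) \<le> B"
    by (rule B) (simp add: norm_mult norm_power a)
  then have "2 ^ m * norm (L z) \<le> B"
    by (simp add: iter norm_mult norm_power)
  then show False using m Lz by (simp add: divide_less_eq)
qed

text \<open>Repeated multiplication by \<open>a\<close> carries each point of the punctured disc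
  into the compact annulus \<open>K\<close>, and each multiplication only increases the modulus of
  \<open>L\<close>.\<close>

lemma scaling_equation_bounded_near_0:
  fixes L :: "complex \<Rightarrow> complex"
  assumes L: "L holomorphic_on -{0}" and a: "norm a > 1"
    and eq: "\<And>z. z \<noteq> 0 \<Longrightarrow> L (a * z) = 2 * L z"
  obtains B where "\<And>z. z \<noteq> 0 \<Longrightarrow> norm z \<le> 1 \<Longrightarrow> norm (L z) \<le> B"
proof -
  have a0: "a \<noteq> 0" using a by auto
  define K where "K = cball 0 (norm a) - ball (0::complex) 1"
  have "compact K" unfolding K_def by (intro compact_diff) auto
  moreover have "continuous_on K L"
    by (rule continuous_on_subset[OF holomorphic_on_imp_continuous_on[OF L]]) (auto simp: K_def)
  ultimately have "bounded (L ` K)"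
    by (intro compact_imp_bounded compact_continuous_image) auto
  then obtain B where B: "\<And>w. w \<in> K \<Longrightarrow> norm (L w) \<le> B"
    unfolding bounded_iff by (metis image_eqI)
  show thesis
  proof
    fix z :: complex assume z: "z \<noteq> 0" "norm z \<le> 1"
    have iter: "L (a ^ m * z) = 2 ^ m * L z" for m
    proof (induction m)
      case (Suc m)
      then show ?case using eq[of "a ^ m * z"] a0 z by (simp add: mult.assoc)
    qed simp
    define P where "P = (\<lambda>m. norm a ^ m * norm z \<ge> 1)"
    \<comment> \<open>The first power that leaves the open unit disc overshoots by a factor of at
      most \<open>norm a\<close>, hence lands in \<open>K\<close>.\<close>
    define m where "m = (LEAST m. P m)"
    obtain k where "1 / norm z < norm a ^ k"
      using real_arch_pow[OF a] by blast
    then have "P k" using z by (simp add: P_def field_simps)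
    then have Pm: "P m" unfolding m_def by (rule LeastI)
    have "norm a ^ m * norm z \<le> norm a"
    proof (cases m)
      case 0
      then show ?thesis using z a by simp
    next
      case (Suc j)
      then have "j < m" by simp
      then have "\<not> P j" unfolding m_def by (rule not_less_Least)
      then have "norm a * (norm a ^ j * norm z) \<le> norm a * 1"
        unfolding P_def using a by (intro mult_left_mono) auto
      then show ?thesis by (simp add: Suc mult.assoc)
    qed
    then have "norm (L (a ^ m * z)) \<le> B"
      using Pm by (intro B) (auto simp: K_def P_def norm_mult norm_power)
    then have "2 ^ m * norm (L z) \<le> B"
      by (simp add: iter norm_mult norm_power)
    moreover have "1 * norm (L z) \<le> 2 ^ m * norm (L z)"
      by (intro mult_right_mono) auto
    ultimately show "norm (L z) \<le> B" by linarith
  qed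
qed

text \<open>\<open>L\<close> extends over 0 with a zero of some order \<open>n\<close>. The quotient
  \<open>M = L / w ^ n\<close> is multiplied by a constant \<open>q\<close> under
  \<open>w \<mapsto> a * w\<close> and has a nonzero limit at 0; following \<open>w / a ^ m\<close>
  to 0 gives first \<open>q = 1\<close>, then that \<open>M\<close> is constant.\<close>

lemma scaling_equation_monomial:
  fixes L :: "complex \<Rightarrow> complex"
  assumes L: "L holomorphic_on -{0}" and a: "norm a > 1"
    and eq: "\<And>z. z \<noteq> 0 \<Longrightarrow> L (a * z) = 2 * L z"
    and nontriv: "z0 \<noteq> 0" "L z0 \<noteq> 0"
  obtains c n where "c \<noteq> 0" "0 < n" "\<And>z. z \<noteq> 0 \<Longrightarrow> L z = c * z ^ n"
proof -
  have a0: "a \<noteq> 0" using a by auto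
  obtain B where B: "\<And>z. z \<noteq> 0 \<Longrightarrow> norm z \<le> 1 \<Longrightarrow> norm (L z) \<le> B"
    using scaling_equation_bounded_near_0[OF L a eq] by blast
  have "\<forall>\<^sub>F z in at 0. norm (L z) \<le> B"
    unfolding eventually_at using B by (intro exI[of _ 1]) auto
  then obtain g where g: "g holomorphic_on UNIV" "\<And>z. z \<noteq> 0 \<Longrightarrow> g z = L z"
    using holomorphic_on_extend_bounded[of L UNIV 0] L by (auto simp: Compl_eq_Diff_UNIV)
  have cont: "isCont g z" for z
    using g(1) by (metis UNIV_I continuous_on_eq_continuous_at holomorphic_on_imp_continuous_on open_UNIV)
  \<comment> \<open>By continuity the functional equation persists at 0, where it reads
    \<open>g 0 = 2 * g 0\<close>.\<close>
  have "((\<lambda>z. g (a * z) - 2 * g z) \<longlongrightarrow> g (a * 0) - 2 * g 0) (at 0)"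
    by (intro tendsto_intros isCont_tendsto_compose[OF cont])
  moreover have "((\<lambda>z. g (a * z) - 2 * g z) \<longlongrightarrow> 0) (at 0)"
    by (rule tendsto_eventually) (auto simp: eventually_at_filter g(2) eq a0)
  ultimately have "g (a * 0) - 2 * g 0 = 0"
    by (rule LIM_unique)
  then have g0: "g 0 = 0" by simp
  have "\<not> g constant_on UNIV"
    using g0 g(2)[OF nontriv(1)] nontriv(2) by (metis UNIV_I constant_on_def)
  then obtain h r n where n: "0 < n" and r: "0 < r" and h: "h holomorphic_on ball 0 r"
      "\<And>w. w \<in> ball 0 r \<Longrightarrow> g w = (w - 0) ^ n * h w" "\<And>w. w \<in> ball 0 r \<Longrightarrow> h w \<noteq> 0"
    by (rule holomorphic_factor_zero_nonconstant[OF g(1) open_UNIV connected_UNIV UNIV_I g0]) blast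
  have h0: "h 0 \<noteq> 0" using h(3) r by simp
  define M where "M = (\<lambda>w. L w / w ^ n)"
  have "isCont h 0"
    using h(1) r by (metis centre_in_ball continuous_on_eq_continuous_at holomorphic_on_imp_continuous_on open_ball)
  then have "(h \<longlongrightarrow> h 0) (at 0)" by (simp add: isCont_def)
  then have M0: "(M \<longlongrightarrow> h 0) (at 0)"
  proof (rule Lim_transform_eventually)
    show "\<forall>\<^sub>F w in at 0. h w = M w"
      unfolding eventually_at
    proof (intro exI[of _ r] conjI ballI impI r)
      fix w :: complex assume w: "w \<noteq> 0 \<and> dist w 0 < r"
      then have "L w = w ^ n * h w" using g(2)[of w] h(2)[of w] by auto
      then show "h w = M w" using w by (simp add: M_def)
    qed
  qed
  define q where "q = 2 / a ^ n"
  have Mq: "M (a * w) = q * M w" if "w \<noteq> 0" for w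
    by (simp add: M_def q_def eq that power_mult_distrib)
  have X: "(\<lambda>m. M (w / a ^ m)) \<longlonglongrightarrow> h 0"
    and X_Suc: "M (w / a ^ m) = q * M (w / a ^ Suc m)" if "w \<noteq> 0" for w m
  proof -
    have "(\<lambda>m. inverse a ^ m) \<longlonglongrightarrow> 0"
      by (rule LIMSEQ_power_zero) (use a in \<open>simp add: inverse_eq_divide norm_divide divide_less_eq_1\<close>)
    then have "(\<lambda>m. w * inverse a ^ m) \<longlonglongrightarrow> w * 0"
      by (rule tendsto_mult_left)
    then have "(\<lambda>m. w / a ^ m) \<longlonglongrightarrow> 0"
      by (simp add: divide_inverse power_inverse)
    then have "filterlim (\<lambda>m. w / a ^ m) (at 0) sequentially"
      using that a0 by (intro filterlim_atI) auto
    from filterlim_compose[OF M0 this] show "(\<lambda>m. M (w / a ^ m)) \<longlonglongrightarrow> h 0" .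
    show "M (w / a ^ m) = q * M (w / a ^ Suc m)"
      using Mq[of "w / a ^ Suc m"] that a0 by (simp add: field_simps)
  qed
  \<comment> \<open>The sequence and its shift have the same limit, yet differ by the factor
    \<open>q\<close>.\<close>
  have "(\<lambda>m. q * M (1 / a ^ Suc m)) \<longlonglongrightarrow> q * h 0"
    by (rule tendsto_mult_left[OF LIMSEQ_Suc[OF X[OF one_neq_zero]]])
  then have "(\<lambda>m. M (1 / a ^ m)) \<longlonglongrightarrow> q * h 0"
    by (simp only: X_Suc[OF one_neq_zero, symmetric])
  then have "q * h 0 = h 0"
    using X[OF one_neq_zero] by (rule LIMSEQ_unique)
  then have q1: "q = 1" using h0 by simp
  have "M w = h 0" if "w \<noteq> 0" for w
  proof -
    have "M (w / a ^ m) = M w" for m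
    proof (induction m)
      case (Suc m)
      then show ?case using X_Suc[OF that, of m] q1 by simp
    qed simp
    then show ?thesis using X[OF that] by (simp add: LIMSEQ_const_iff)
  qed
  then have "L w = h 0 * w ^ n" if "w \<noteq> 0" for w
    using that by (force simp: M_def divide_eq_eq)
  then show thesis by (rule that[OF h0 n])
qed

section \<open>Field automorphisms of the complex numbers\<close>

text \<open>Additivity comes from \<open>x + y = x * (1 + y / x)\<close>, once the shift rule also
  covers 0 and -1. The latter amounts to \<open>\<sigma> (-1) = -1\<close>.\<close>

lemma multiplicative_shift_imp_additive:
  fixes \<sigma> :: "complex \<Rightarrow> complex"
  assumes 0: "\<sigma> 0 = 0" and 1: "\<sigma> 1 = 1" and mult: "\<And>x y. \<sigma> (x * y) = \<sigma> x * \<sigma> y"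
    and shift: "\<And>x. x \<noteq> 0 \<Longrightarrow> x \<noteq> -1 \<Longrightarrow> \<sigma> (1 + x) = 1 + \<sigma> x"
  shows "\<sigma> (x + y) = \<sigma> x + \<sigma> y"
proof -
  have sq: "\<sigma> (-1) * \<sigma> (-1) = 1"
    using mult[of "-1" "-1"] 1 by simp
  have "\<sigma> (-1) \<noteq> 1"
  \<comment> \<open>Otherwise \<open>\<sigma> (-2) = \<sigma> 2 = 2\<close>, and the shift rule at
    -2 would give \<open>1 = 3\<close>.\<close>
  proof
    assume m1: "\<sigma> (-1) = 1"
    have "\<sigma> 2 = 2" using shift[of 1] 1 by simp
    then have "\<sigma> (-2) = 2" using mult[of "-1" 2] m1 by simp
    then show False using shift[of "-2"] m1 by simp
  qed
  then have m1: "\<sigma> (-1) = -1"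
    using sq by (metis square_eq_1_iff)
  have shift': "\<sigma> (1 + t) = 1 + \<sigma> t" for t
    using shift[of t] 0 1 m1 by (cases "t = 0"; cases "t = -1") auto
  show ?thesis
  proof (cases "x = 0")
    case False
    then have "x * (1 + y / x) = x + y" by (simp add: distrib_left)
    then have "\<sigma> (x + y) = \<sigma> (x * (1 + y / x))" by simp
    also have "\<dots> = \<sigma> x * (1 + \<sigma> (y / x))"
      by (simp only: mult shift')
    also have "\<dots> = \<sigma> x + \<sigma> (x * (y / x))"
      by (simp only: mult distrib_left mult_1_right)
    finally show ?thesis using False by simp
  qed (simp add: 0)
qed

text \<open>By rational scaling, preimages of the unit disc are bounded by some \<open>D\<close>.
  Approximating a real \<open>w\<close> by fractions \<open>p / k\<close> then shows that its
  preimage is \<open>w\<close> itself, so \<sigma> fixes the reals and sends \<open>\<i>\<close> to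
  a square root of -1.\<close>

lemma field_automorphism_locally_bounded_inverse_cases:
  fixes \<sigma> :: "complex \<Rightarrow> complex"
  assumes surj: "surj \<sigma>" and 1: "\<sigma> 1 = 1"
    and add: "\<And>x y. \<sigma> (x + y) = \<sigma> x + \<sigma> y" and mult: "\<And>x y. \<sigma> (x * y) = \<sigma> x * \<sigma> y"
    and bound: "\<And>z. norm (\<sigma> z) < 1 / real (Suc n) \<Longrightarrow> norm z \<le> C"
  shows "(\<forall>z. \<sigma> z = z) \<or> (\<forall>z. \<sigma> z = cnj z)"
proof -
  have 0: "\<sigma> 0 = 0" using add[of 0 0] by simp
  have minus: "\<sigma> (- x) = - \<sigma> x" for x
    using add[of x "-x"] 0 by (simp add: add_eq_0_iff)
  have of_nat: "\<sigma> (of_nat k) = of_nat k" for k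
    by (induction k) (auto simp: 0 1 add)
  have of_int: "\<sigma> (of_int k) = of_int k" for k
    by (cases k rule: int_cases2) (auto simp: minus of_nat)
  \<comment> \<open>One more than \<open>Suc n\<close>, since \<open>bound\<close> asks for a strict
    inequality.\<close>
  define N where "N = n + 2"
  have N: "N > 0" by (simp add: N_def)
  define D where "D = real N * C"
  have unit_bound: "norm u \<le> D" if "norm (\<sigma> u) \<le> 1" for u
  proof -
    define v where "v = u / of_nat N"
    have u: "u = of_nat N * v" using N by (simp add: v_def)
    then have "\<sigma> u = of_nat N * \<sigma> v" using mult of_nat by metis
    then have "norm (\<sigma> u) = real N * norm (\<sigma> v)"
      by (simp only: norm_mult norm_of_nat)
    then have "norm (\<sigma> v) \<le> 1 / real N"
      using that N by (simp add: field_simps)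
    also have "\<dots> < 1 / real (Suc n)" by (simp add: N_def field_simps)
    finally have "norm v \<le> C" by (rule bound)
    then have "real N * norm v \<le> D"
      unfolding D_def by (intro mult_left_mono) auto
    then show ?thesis by (simp only: u norm_mult norm_of_nat)
  qed
  have real: "\<sigma> (of_real w) = of_real w" for w
  proof -
    obtain z where z: "\<sigma> z = of_real w" using surj by (metis surj_def)
    have est: "norm (z - of_real w) \<le> (D + 1) / real k" if "k > 0" for k :: nat
    proof -
      \<comment> \<open>The image of \<open>k * z - p\<close> is the fractional part of
        \<open>k * w\<close>, so \<open>unit_bound\<close> applies for every
        \<open>k\<close>.\<close>
      define p where "p = \<lfloor>real k * w\<rfloor>"
      have p: "\<bar>real k * w - of_int p\<bar> \<le> 1" unfolding p_def by linarith
      have "\<sigma> (of_nat k * z - of_int p) = of_nat k * of_real w - of_int p"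
        using add[of "of_nat k * z" "- of_int p"] by (simp add: minus mult of_nat of_int z)
      also have "\<dots> = of_real (real k * w - of_int p)" by simp
      finally have "norm (of_nat k * z - of_int p) \<le> D"
        using p by (intro unit_bound) (simp only: norm_of_real)
      moreover have "norm (of_real (real k * w - of_int p) :: complex) \<le> 1"
        using p by (simp only: norm_of_real)
      ultimately have "norm ((of_nat k * z - of_int p) - of_real (real k * w - of_int p)) \<le> D + 1"
        using norm_triangle_ineq4 by (smt (verit))
      also have "(of_nat k * z - of_int p) - of_real (real k * w - of_int p) = of_nat k * (z - of_real w)"
        by (simp add: algebra_simps)
      finally have "norm (z - of_real w) * real k \<le> D + 1"
        by (simp only: norm_mult norm_of_nat mult.commute)
      then show ?thesis using that by (simp add: pos_le_divide_eq)
    qed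
    have "(\<lambda>k. (D + 1) / real k) \<longlonglongrightarrow> 0"
      by (rule lim_const_over_n)
    then have "norm (z - of_real w) \<le> 0"
      by (rule tendsto_lowerbound)
        (auto simp: eventually_sequentially intro!: exI[of _ 1] est)
    then show ?thesis using z by simp
  qed
  have "\<sigma> \<i> * \<sigma> \<i> = -1"
    using mult[of \<i> \<i>] minus[of 1] 1 by simp
  then have "(\<sigma> \<i> - \<i>) * (\<sigma> \<i> + \<i>) = 0"
    by (simp add: algebra_simps)
  then have i: "\<sigma> \<i> = \<i> \<or> \<sigma> \<i> = - \<i>"
    by (simp add: add_eq_0_iff2)
  have decomp: "\<sigma> z = of_real (Re z) + \<sigma> \<i> * of_real (Im z)" for z
  proof -
    have "\<sigma> z = \<sigma> (of_real (Re z) + \<i> * of_real (Im z))"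
      by (rule arg_cong[OF complex_eq])
    then show ?thesis by (simp only: add mult real)
  qed
  from i show ?thesis
  proof
    assume "\<sigma> \<i> = \<i>"
    then have "\<sigma> z = z" for z
      by (subst decomp) (simp add: complex_eq_iff)
    then show ?thesis by blast
  next
    assume "\<sigma> \<i> = - \<i>"
    then have "\<sigma> z = cnj z" for z
      by (subst decomp) (simp add: complex_eq_iff)
    then show ?thesis by blast
  qed
qed

section \<open>Conjugating maps\<close>

text \<open>A Weierstrass product. Values of \<open>a\<close> may repeat, but each only finitely
  often because \<open>a\<close> tends to infinity.\<close>

lemma entire_vanishing_on_sequence:
  assumes "filterlim a at_infinity sequentially" and nz: "\<And>n. a n \<noteq> (0::complex)"
  obtains W where "W holomorphic_on UNIV" "\<And>z. W z = 0 \<longleftrightarrow> z \<in> range a"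
proof -
  have "finite (a -` {z})" for z
  proof -
    have "\<forall>\<^sub>F n in sequentially. norm (a n) > norm z"
      using filterlim_at_infinity_imp_norm_at_top[OF assms(1)] by (simp add: filterlim_at_top_dense)
    then obtain N where N: "\<And>n. n \<ge> N \<Longrightarrow> norm (a n) > norm z"
      by (auto simp: eventually_at_top_linorder)
    have "a -` {z} \<subseteq> {..<N}"
      using N by (force simp: not_less[symmetric])
    then show ?thesis by (rule finite_subset) simp
  qed
  then interpret weierstrass_product' a
    by unfold_locales (use assms in auto)
  show thesis using that[of f] holomorphic zero by blast
qed

text \<open>The conjugate of \<open>f\<close> is described by the relation
  \<open>g (\<phi> z) = \<phi> (f z)\<close> rather than through \<open>inv_into\<close>, so that
  changing \<phi> by an automorphism is a matter of composing functions.\<close>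

locale punctured_conjugation =
  fixes \<phi> :: "complex \<Rightarrow> complex"
  assumes bij: "bij_betw \<phi> (-{0}) (-{0})"
    and conj: "\<And>f. f holomorphic_on -{0} \<Longrightarrow> (\<And>z. z \<noteq> 0 \<Longrightarrow> f z \<noteq> 0) \<Longrightarrow>
      \<exists>g. g holomorphic_on -{0} \<and> (\<forall>z. z \<noteq> 0 \<longrightarrow> g z \<noteq> 0 \<and> g (\<phi> z) = \<phi> (f z))"
begin

section \<open>Conjugates of rotations, and multiplicativity up to a constant\<close>

lemma nonzero: "z \<noteq> 0 \<Longrightarrow> \<phi> z \<noteq> 0"
  using bij_betw_apply[OF bij, of z] by simp

lemma inject: "z \<noteq> 0 \<Longrightarrow> w \<noteq> 0 \<Longrightarrow> \<phi> z = \<phi> w \<Longrightarrow> z = w"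
  using inj_onD[OF bij_betw_imp_inj_on[OF bij]] by simp

lemma preimage:
  assumes "w \<noteq> 0"
  obtains z where "z \<noteq> 0" "\<phi> z = w"
proof -
  have "w \<in> \<phi> ` (-{0})"
    using assms bij_betw_imp_surj_on[OF bij] by simp
  then show thesis using that by auto
qed

text \<open>If \<open>g\<close> is the conjugate of \<open>f\<close> under \<phi>, the new conjugate
  is \<open>\<alpha> \<circ> g \<circ> \<beta>\<close>. This serves to normalize \<phi> at 1 and to
  pass to \<open>1 / \<phi>\<close>.\<close>

lemma compose_automorphism:
  assumes hol: "\<alpha> holomorphic_on -{0}" "\<beta> holomorphic_on -{0}"
    and nz: "\<And>z. z \<noteq> 0 \<Longrightarrow> \<alpha> z \<noteq> 0" "\<And>z. z \<noteq> 0 \<Longrightarrow> \<beta> z \<noteq> 0"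
    and inv: "\<And>z. z \<noteq> 0 \<Longrightarrow> \<beta> (\<alpha> z) = z" "\<And>z. z \<noteq> 0 \<Longrightarrow> \<alpha> (\<beta> z) = z"
  shows "punctured_conjugation (\<lambda>z. \<alpha> (\<phi> z))"
proof
  have \<beta>_image: "\<beta> ` (-{0}) \<subseteq> -{0}" and \<alpha>_image: "\<alpha> ` (-{0}) \<subseteq> -{0}"
    using nz by force+
  then have "bij_betw \<alpha> (-{0}) (-{0})"
    by (intro bij_betw_byWitness[where f' = \<beta>]) (simp_all add: inv)
  from bij_betw_trans[OF bij this] show "bij_betw (\<lambda>z. \<alpha> (\<phi> z)) (-{0}) (-{0})"
    by (simp add: o_def)
  fix f assume f: "f holomorphic_on -{0}" "\<And>z. z \<noteq> 0 \<Longrightarrow> f z \<noteq> 0"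
  obtain g where g: "g holomorphic_on -{0}" "\<And>z. z \<noteq> 0 \<Longrightarrow> g z \<noteq> 0"
      "\<And>z. z \<noteq> 0 \<Longrightarrow> g (\<phi> z) = \<phi> (f z)"
    using conj[OF f] by blast
  have g_nz: "g (\<beta> z) \<noteq> 0" if "z \<noteq> 0" for z
    using that by (intro g(2) nz(2))
  have "(g \<circ> \<beta>) holomorphic_on -{0}"
    by (rule holomorphic_on_compose_gen[OF hol(2) g(1) \<beta>_image])
  then have hol': "(\<alpha> \<circ> (g \<circ> \<beta>)) holomorphic_on -{0}"
    by (rule holomorphic_on_compose_gen[OF _ hol(1)]) (use g_nz in force)
  show "\<exists>g. g holomorphic_on -{0} \<and>
      (\<forall>z. z \<noteq> 0 \<longrightarrow> g z \<noteq> 0 \<and> g (\<alpha> (\<phi> z)) = \<alpha> (\<phi> (f z)))"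
  proof (intro exI[of _ "\<alpha> \<circ> (g \<circ> \<beta>)"] conjI hol' allI impI)
    fix z :: complex assume z: "z \<noteq> 0"
    show "(\<alpha> \<circ> (g \<circ> \<beta>)) z \<noteq> 0" using nz(1)[OF g_nz[OF z]] by simp
    show "(\<alpha> \<circ> (g \<circ> \<beta>)) (\<alpha> (\<phi> z)) = \<alpha> (\<phi> (f z))"
      by (simp add: inv(1)[OF nonzero[OF z]] g(3)[OF z])
  qed
qed

text \<open>The conjugates of multiplication by \<open>a\<close> and by \<open>inverse a\<close> are
  mutually inverse, so the classification of automorphisms applies.\<close>

lemma rotation_cases:
  assumes a: "a \<noteq> 0"
  obtains b where "b \<noteq> 0"
    "(\<forall>z. z \<noteq> 0 \<longrightarrow> \<phi> (a * z) = b * \<phi> z) \<or> (\<forall>z. z \<noteq> 0 \<longrightarrow> \<phi> (a * z) = b / \<phi> z)"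
proof -
  have *: "\<exists>g. g holomorphic_on -{0} \<and> (\<forall>z. z \<noteq> 0 \<longrightarrow> g z \<noteq> 0 \<and> g (\<phi> z) = \<phi> (c * z))"
    if "c \<noteq> 0" for c
    by (rule conj) (use that in \<open>auto intro!: holomorphic_intros\<close>)
  obtain g where g: "g holomorphic_on -{0}" "\<And>z. z \<noteq> 0 \<Longrightarrow> g z \<noteq> 0"
      "\<And>z. z \<noteq> 0 \<Longrightarrow> g (\<phi> z) = \<phi> (a * z)"
    using *[OF a] by blast
  obtain g' where g': "g' holomorphic_on -{0}" "\<And>z. z \<noteq> 0 \<Longrightarrow> g' z \<noteq> 0"
      "\<And>z. z \<noteq> 0 \<Longrightarrow> g' (\<phi> z) = \<phi> (inverse a * z)"
    using *[of "inverse a"] a by auto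
  have inv: "g' (g w) = w" if "w \<noteq> 0" for w
  proof -
    obtain z where z: "z \<noteq> 0" "\<phi> z = w" by (rule preimage[OF \<open>w \<noteq> 0\<close>])
    have "g' (g w) = \<phi> (inverse a * (a * z))"
      using z a g(3)[of z] g'(3)[of "a * z"] by simp
    also have "inverse a * (a * z) = z" using a by simp
    finally show ?thesis using z by simp
  qed
  obtain b where "b \<noteq> 0" "(\<forall>z. z \<noteq> 0 \<longrightarrow> g z = b * z) \<or> (\<forall>z. z \<noteq> 0 \<longrightarrow> g z = b / z)"
    by (rule biholomorphic_punctured_cases[OF g(1) g'(1) g(2) g'(2) inv])
  then show thesis
    using g(3) nonzero that[of b] by metis
qed

text \<open>Multiplication by \<open>a\<close> is the square of multiplication by a root
  \<open>c\<close>. If the latter becomes \<open>w \<mapsto> b / w\<close>, an involution, its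
  square becomes the identity, which is still of the desired form.\<close>

lemma rotation:
  assumes a: "a \<noteq> 0"
  obtains b where "b \<noteq> 0" "\<And>z. z \<noteq> 0 \<Longrightarrow> \<phi> (a * z) = b * \<phi> z"
proof -
  define c where "c = csqrt a"
  have c: "c \<noteq> 0" "c * c = a"
    using a by (auto simp: c_def simp flip: power2_eq_square)
  obtain b where b: "b \<noteq> 0" and cases:
    "(\<forall>z. z \<noteq> 0 \<longrightarrow> \<phi> (c * z) = b * \<phi> z) \<or> (\<forall>z. z \<noteq> 0 \<longrightarrow> \<phi> (c * z) = b / \<phi> z)"
    by (rule rotation_cases[OF c(1)])
  have sq: "\<phi> (a * z) = \<phi> (c * (c * z))" for z
    by (simp add: c(2)[symmetric] mult.assoc)
  from cases show thesis
  proof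
    assume "\<forall>z. z \<noteq> 0 \<longrightarrow> \<phi> (c * z) = b * \<phi> z"
    then have "\<phi> (a * z) = (b * b) * \<phi> z" if "z \<noteq> 0" for z
      using that c(1) by (simp add: sq)
    then show thesis using that[of "b * b"] b by simp
  next
    assume "\<forall>z. z \<noteq> 0 \<longrightarrow> \<phi> (c * z) = b / \<phi> z"
    then have "\<phi> (a * z) = 1 * \<phi> z" if "z \<noteq> 0" for z
      using that c(1) b by (simp add: sq nonzero)
    then show thesis using that[of 1] by simp
  qed
qed

lemma mult_unnormalized:
  assumes "a \<noteq> 0" "z \<noteq> 0"
  shows "\<phi> (a * z) * \<phi> 1 = \<phi> a * \<phi> z"
proof -
  obtain b where "\<And>z. z \<noteq> 0 \<Longrightarrow> \<phi> (a * z) = b * \<phi> z"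
    using rotation[OF assms(1)] by metis
  from this[OF assms(2)] this[of 1] show ?thesis by simp
qed

end

section \<open>Normalized multiplicative conjugations and their extension to a field
  automorphism\<close>

locale multiplicative_punctured_conjugation = punctured_conjugation +
  assumes mult: "x \<noteq> 0 \<Longrightarrow> y \<noteq> 0 \<Longrightarrow> \<phi> (x * y) = \<phi> x * \<phi> y"
begin

lemma one: "\<phi> 1 = 1"
  using mult[OF one_neq_zero one_neq_zero, symmetric] nonzero[OF one_neq_zero] by simp

text \<open>\<open>L\<close> is the logarithmic derivative \<open>w * G' / G\<close> of the
  conjugate \<open>G\<close> of \<open>exp\<close>; it turns the product rule for \<open>G\<close>
  into a sum. The conditions on \<open>x\<close> keep \<open>x\<close> and \<open>1 + x\<close> in
  the punctured plane.\<close>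

lemma exp_conjugate:
  obtains L where "L holomorphic_on -{0}"
    "\<And>x z. x \<noteq> 0 \<Longrightarrow> x \<noteq> -1 \<Longrightarrow> z \<noteq> 0 \<Longrightarrow> L (\<phi> (1 + x) * z) = L z + L (\<phi> x * z)"
    "\<exists>z. z \<noteq> 0 \<and> L z \<noteq> 0"
proof -
  obtain G where G: "G holomorphic_on -{0}" "\<And>z. z \<noteq> 0 \<Longrightarrow> G z \<noteq> 0"
      "\<And>z. z \<noteq> 0 \<Longrightarrow> G (\<phi> z) = \<phi> (exp z)"
    using conj[of exp] by (auto intro!: holomorphic_intros)
  have DG: "(G has_field_derivative deriv G z) (at z)" if "z \<noteq> 0" for z
    by (rule holomorphic_derivI[OF G(1)]) (use that in auto)
  define L where "L = (\<lambda>z. z * deriv G z / G z)"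
  show thesis
  proof
    have "deriv G holomorphic_on -{0}"
      by (rule holomorphic_deriv[OF G(1)]) auto
    then show "L holomorphic_on -{0}"
      unfolding L_def by (intro holomorphic_intros G) (use G(2) in auto)
  next
    fix x z :: complex assume x: "x \<noteq> 0" "x \<noteq> -1" and z: "z \<noteq> 0"
    have x1: "1 + x \<noteq> 0" using x(2) by (metis add_eq_0_iff2 add.commute)
    define b c where "b = \<phi> (1 + x)" and "c = \<phi> x"
    have b: "b \<noteq> 0" and c: "c \<noteq> 0"
      unfolding b_def c_def using nonzero x x1 by auto
    have Geq: "G (b * w) = G w * G (c * w)" if w: "w \<noteq> 0" for w
    proof -
      obtain u where u: "u \<noteq> 0" "\<phi> u = w" by (rule preimage[OF w])
      have xu: "x * u \<noteq> 0" using x u by simp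
      have "G (b * w) = G (\<phi> ((1 + x) * u))"
        unfolding b_def u(2)[symmetric] using mult[OF x1 u(1)] by simp
      also have "\<dots> = \<phi> (exp ((1 + x) * u))"
        using x1 u(1) by (intro G) simp
      also have "\<dots> = \<phi> (exp u * exp (x * u))"
        by (simp add: distrib_right exp_add)
      also have "\<dots> = G (\<phi> u) * G (\<phi> (x * u))"
        by (simp only: mult[OF exp_not_eq_zero exp_not_eq_zero] G(3)[OF u(1)] G(3)[OF xu])
      finally show ?thesis using x u by (simp add: mult c_def)
    qed
    have "((\<lambda>w. G (b * w)) has_field_derivative deriv G (b * z) * b) (at z)"
      using b z by (intro DERIV_chain2[where f = G] DG) (auto intro!: derivative_eq_intros)
    moreover have "((\<lambda>w. G (b * w)) has_field_derivative
        (deriv G z * G (c * z) + deriv G (c * z) * c * G z)) (at z)"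
    proof (rule has_field_derivative_transform_within_open[where S = "-{0}"])
      show "((\<lambda>w. G w * G (c * w)) has_field_derivative
        (deriv G z * G (c * z) + deriv G (c * z) * c * G z)) (at z)"
        using c z by (intro DERIV_mult DERIV_chain2[where f = G] DG) (auto intro!: derivative_eq_intros)
    qed (use Geq z in auto)
    ultimately have "deriv G (b * z) * b = deriv G z * G (c * z) + deriv G (c * z) * c * G z"
      by (rule DERIV_unique)
    then have "L (b * z) = z * (deriv G z * G (c * z) + deriv G (c * z) * c * G z) / (G z * G (c * z))"
      unfolding L_def Geq[OF z] by (simp add: ac_simps)
    also have "\<dots> = L z + L (c * z)"
      using G(2)[of z] G(2)[of "c * z"] z c by (simp add: L_def field_simps)
    finally show "L (\<phi> (1 + x) * z) = L z + L (\<phi> x * z)"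
      by (simp add: b_def c_def)
  next
    show "\<exists>z. z \<noteq> 0 \<and> L z \<noteq> 0"
    proof (rule ccontr)
      assume "\<not> ?thesis"
      then have "deriv G z = 0" if "z \<noteq> 0" for z
        using that G(2) by (auto simp: L_def)
      then have "(G has_field_derivative 0) (at z)" if "z \<noteq> 0" for z
        using DG that by metis
      then have "G constant_on -{0}"
        by (intro has_field_derivative_0_imp_constant_on connected_punctured_universe) auto
      \<comment> \<open>A vanishing \<open>L\<close> would make \<open>G\<close> constant, but
        \<open>exp\<close> takes the distinct values -1 and 1 at these two points.\<close>
      then have "G (\<phi> (\<i> * pi)) = G (\<phi> (2 * pi * \<i>))"
        using nonzero[of "\<i> * pi"] nonzero[of "2 * pi * \<i>"] unfolding constant_on_def by auto
      then have "\<phi> (exp (\<i> * pi)) = \<phi> (exp (2 * pi * \<i>))"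
        using G(3)[of "\<i> * pi"] G(3)[of "2 * pi * \<i>"] by simp
      then have "exp (\<i> * pi) = exp (2 * pi * \<i>)"
        by (rule inject[OF exp_not_eq_zero exp_not_eq_zero])
      then show False by (simp add: exp_two_pi_i)
    qed
  qed
qed

text \<open>The equation for \<open>x = 1\<close> reads \<open>L (\<phi> 2 * z) = 2 * L z\<close>,
  which on the unit circle forces \<open>L = 0\<close>.\<close>

lemma norm_2_neq_1: "norm (\<phi> 2) \<noteq> 1"
proof
  assume n: "norm (\<phi> 2) = 1"
  obtain L where L: "L holomorphic_on -{0}"
    "\<And>x z. x \<noteq> 0 \<Longrightarrow> x \<noteq> -1 \<Longrightarrow> z \<noteq> 0 \<Longrightarrow> L (\<phi> (1 + x) * z) = L z + L (\<phi> x * z)"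
    "\<exists>z. z \<noteq> 0 \<and> L z \<noteq> 0"
    by (rule exp_conjugate) (rule that)
  have "L (\<phi> 2 * z) = 2 * L z" if "z \<noteq> 0" for z
    using L(2)[of 1 z] that by (simp add: one)
  from scaling_equation_unit_zero[OF L(1) n this] L(3) show False by blast
qed

text \<open>The value of \<phi> at 0 is arbitrary; it is set to 0 to obtain a candidate for a field
  automorphism.\<close>

definition extension :: "complex \<Rightarrow> complex" where
  "extension z = (if z = 0 then 0 else \<phi> z)"

lemma extension_0: "extension 0 = 0" and extension_1: "extension 1 = 1"
  and extension_mult: "extension (x * y) = extension x * extension y"
  by (auto simp: extension_def one mult)

lemma surj_extension: "surj extension"
proof -
  have "\<exists>x. extension x = w" for w
  proof (cases "w = 0")
    case False
    then obtain x where "x \<noteq> 0" "\<phi> x = w" by (rule preimage)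
    then show ?thesis by (intro exI[of _ x]) (simp add: extension_def)
  qed (use extension_0 in blast)
  then show ?thesis by (metis surj_def)
qed

text \<open>With \<open>L w = c * w ^ n\<close>, the equation at \<open>w = 1\<close> is the shift
  rule for \<open>\<phi> ^ n\<close>, so the \<open>n\<close>-th power of \<open>extension\<close>
  is additive. Injectivity then leaves only one \<open>n\<close>-th root of unity, whence
  \<open>n = 1\<close>.\<close>

lemma extension_add:
  assumes "norm (\<phi> 2) > 1"
  shows "extension (x + y) = extension x + extension y"
proof -
  obtain L where L: "L holomorphic_on -{0}"
    "\<And>x z. x \<noteq> 0 \<Longrightarrow> x \<noteq> -1 \<Longrightarrow> z \<noteq> 0 \<Longrightarrow> L (\<phi> (1 + x) * z) = L z + L (\<phi> x * z)"
    "\<exists>z. z \<noteq> 0 \<and> L z \<noteq> 0"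
    by (rule exp_conjugate) (rule that)
  have "L (\<phi> 2 * z) = 2 * L z" if "z \<noteq> 0" for z
    using L(2)[of 1 z] that by (simp add: one)
  then obtain c n where cn: "c \<noteq> 0" "0 < n" "\<And>z. z \<noteq> 0 \<Longrightarrow> L z = c * z ^ n"
    using scaling_equation_monomial[OF L(1) assms] L(3) by metis
  have shift: "\<phi> (1 + x) ^ n = 1 + \<phi> x ^ n" if x: "x \<noteq> 0" "x \<noteq> -1" for x
  proof -
    have x1: "1 + x \<noteq> 0" using x(2) by (metis add_eq_0_iff2 add.commute)
    have "c * \<phi> (1 + x) ^ n = c * 1 + c * \<phi> x ^ n"
      using L(2)[OF x, of 1] cn(3)[OF nonzero[OF x1]] cn(3)[OF nonzero[OF x(1)]] cn(3)[of 1] by simp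
    then have "c * \<phi> (1 + x) ^ n = c * (1 + \<phi> x ^ n)"
      by (simp add: distrib_left)
    then show ?thesis using cn(1) by simp
  qed
  define \<sigma> where "\<sigma> = (\<lambda>z. extension z ^ n)"
  have \<sigma>_add: "\<sigma> (x + y) = \<sigma> x + \<sigma> y" for x y
  proof (rule multiplicative_shift_imp_additive[where \<sigma> = \<sigma>])
    show "\<sigma> (1 + x) = 1 + \<sigma> x" if "x \<noteq> 0" "x \<noteq> -1" for x
    proof -
      have "1 + x \<noteq> 0" using that(2) by (metis add_eq_0_iff2 add.commute)
      then show ?thesis using shift[OF that] that by (simp add: \<sigma>_def extension_def)
    qed
  qed (use cn(2) in \<open>auto simp: \<sigma>_def extension_0 extension_1 extension_mult power_mult_distrib\<close>)
  \<comment> \<open>For a root of unity \<open>z = \<phi> x\<close>, additivity gives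
    \<open>\<sigma> (x - 1) = 0\<close>, hence \<open>x = 1\<close>.\<close>
  have root: "z = 1" if z: "z ^ n = 1" for z :: complex
  proof -
    have z0: "z \<noteq> 0" using z cn(2) by (auto simp: power_0_left)
    obtain x where x: "x \<noteq> 0" "\<phi> x = z" by (rule preimage[OF z0])
    have "\<sigma> 1 + \<sigma> (x - 1) = \<sigma> x" using \<sigma>_add[of 1 "x - 1"] by simp
    moreover have "\<sigma> x = 1" "\<sigma> 1 = 1"
      using x z by (auto simp: \<sigma>_def extension_def one)
    ultimately have "\<sigma> (x - 1) = 0" by simp
    then have "x = 1"
      using nonzero[of "x - 1"] by (auto simp: \<sigma>_def extension_def split: if_splits)
    then show ?thesis using x one by simp
  qed
  have "{z::complex. z ^ n = 1} = {1}" using root by auto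
  then have "n = 1" using card_roots_unity_eq[OF cn(2)] by simp
  then show ?thesis using \<sigma>_add by (simp add: \<sigma>_def)
qed

text \<open>A single \<open>n\<close> governs both radius and bound, so the negation directly yields
  \<open>z n\<close> tending to infinity with images tending to 0. The identity theorem then refutes
  this through an entire function with prescribed zeros.\<close>

lemma inverse_locally_bounded:
  assumes add: "\<And>x y. extension (x + y) = extension x + extension y"
  shows "\<exists>n. \<forall>z. norm (extension z) < 1 / real (Suc n) \<longrightarrow> norm z \<le> real (n + 2)"
proof (rule ccontr)
  assume "\<not> ?thesis"
  then obtain z where z: "\<And>n. norm (extension (z n)) < 1 / real (Suc n)"
      "\<And>n. norm (z n) > real (n + 2)"
    by (metis not_le)
  have z0: "z n \<noteq> 0" for n using z(2)[of n] by auto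
  \<comment> \<open>The shift by 1 moves the accumulation point of the images from 0 to 1, inside
    the punctured plane; the bound \<open>n + 2\<close> keeps \<open>a n\<close> nonzero.\<close>
  define a where "a = (\<lambda>n. 1 + z n)"
  have norm_a: "norm (a n) \<ge> real n" "a n \<noteq> 0" for n
  proof -
    have "norm (a n) \<ge> norm (z n) - 1"
      using norm_triangle_ineq2[of "z n" "-1"] by (simp add: a_def add.commute)
    with z(2)[of n] have *: "norm (a n) > real n" by simp
    then show "norm (a n) \<ge> real n" "a n \<noteq> 0" by auto
  qed
  have "filterlim (\<lambda>n. norm (a n)) at_top sequentially"
    by (rule filterlim_at_top_mono[OF filterlim_real_sequentially]) (simp add: norm_a)
  then have "filterlim a at_infinity sequentially"
    by (rule filterlim_norm_at_top_imp_at_infinity)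
  then obtain W where W: "W holomorphic_on UNIV" "\<And>z. W z = 0 \<longleftrightarrow> z \<in> range a"
    using entire_vanishing_on_sequence norm_a(2) by blast
  have "countable (insert 0 (range a))" by simp
  then have "insert 0 (range a) \<noteq> UNIV" using uncountable_UNIV_complex by metis
  then obtain u where u: "u \<noteq> 0" "W u \<noteq> 0" using W(2) by blast
  \<comment> \<open>Thus \<open>f\<close> is 1 at all \<open>a n\<close> but \<open>exp 1\<close> at
    \<open>u\<close>.\<close>
  define f where "f = (\<lambda>z. exp (W z / W u))"
  have "f holomorphic_on -{0}"
    unfolding f_def by (intro holomorphic_intros holomorphic_on_subset[OF W(1)]) (use u in auto)
  then obtain g where g: "g holomorphic_on -{0}" "\<And>z. z \<noteq> 0 \<Longrightarrow> g (\<phi> z) = \<phi> (f z)"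
    using conj[of f] by (auto simp: f_def)
  have \<phi>_a: "\<phi> (a n) = 1 + extension (z n)" for n
    using add[of 1 "z n"] norm_a(2)[of n] by (simp add: extension_1 a_def) (simp add: extension_def)
  have g_a: "g (\<phi> (a n)) - 1 = 0" for n
  proof -
    have "W (a n) = 0" using W(2) by blast
    then show ?thesis using g(2)[OF norm_a(2)] by (simp add: f_def one)
  qed
  have "(\<lambda>n. extension (z n)) \<longlonglongrightarrow> 0"
  proof (rule Lim_null_comparison)
    show "\<forall>\<^sub>F n in sequentially. norm (extension (z n)) \<le> 1 / real (Suc n)"
      using z(1) by (intro always_eventually allI less_imp_le)
    show "(\<lambda>n. 1 / real (Suc n)) \<longlonglongrightarrow> 0"
      using LIMSEQ_Suc[OF lim_1_over_n] by simp
  qed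
  from tendsto_add[OF tendsto_const[of 1] this] have "(\<lambda>n. \<phi> (a n)) \<longlonglongrightarrow> 1"
    by (simp add: \<phi>_a)
  moreover have "\<phi> (a n) \<noteq> 1" for n
    using z0[of n] nonzero[of "z n"] by (simp add: \<phi>_a extension_def)
  ultimately have lim: "1 islimpt range (\<lambda>n. \<phi> (a n))"
    unfolding islimpt_sequential by (intro exI[of _ "\<lambda>n. \<phi> (a n)"]) auto
  \<comment> \<open>The zeros \<open>\<phi> (a n)\<close> of \<open>g - 1\<close> accumulate at 1,
    so \<open>g - 1\<close> vanishes on the whole connected domain.\<close>
  have "(\<lambda>w. g w - 1) (\<phi> u) = 0"
  proof (rule analytic_continuation[where f = "\<lambda>w. g w - 1", OF _ _ _ _ _ lim])
    show "(\<lambda>w. g w - 1) holomorphic_on -{0}"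
      by (intro holomorphic_intros g)
    show "connected (-{0::complex})"
      by (rule connected_punctured_universe) simp
  qed (use g_a nonzero norm_a(2) u in auto)
  then have "\<phi> (exp 1) = \<phi> 1"
    using g(2)[OF u(1)] u(2) by (simp add: f_def one)
  then have "exp (1::complex) = 1"
    by (rule inject[OF exp_not_eq_zero one_neq_zero])
  then have "norm (exp (1::complex)) = 1" by simp
  then show False by (simp add: norm_exp_eq_Re)
qed

lemma identity_or_cnj:
  assumes "norm (\<phi> 2) > 1"
  shows "(\<forall>z. z \<noteq> 0 \<longrightarrow> \<phi> z = z) \<or> (\<forall>z. z \<noteq> 0 \<longrightarrow> \<phi> z = cnj z)"
proof -
  note add = extension_add[OF assms]
  obtain n where n: "\<And>z. norm (extension z) < 1 / real (Suc n) \<Longrightarrow> norm z \<le> real (n + 2)"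
    using inverse_locally_bounded[OF add] by blast
  have "(\<forall>z. extension z = z) \<or> (\<forall>z. extension z = cnj z)"
    by (rule field_automorphism_locally_bounded_inverse_cases
        [OF surj_extension extension_1 add extension_mult n])
  then show ?thesis unfolding extension_def by metis
qed

end

text \<open>Division by \<open>\<phi> 1\<close> makes the map multiplicative; if its value at 2 has
  norm below 1, its reciprocal is used instead.\<close>

lemma (in punctured_conjugation) explicit_cases:
  obtains c where "c \<noteq> 0"
    "(\<forall>z. z \<noteq> 0 \<longrightarrow> \<phi> z = c * z) \<or> (\<forall>z. z \<noteq> 0 \<longrightarrow> \<phi> z = c / z) \<or>
     (\<forall>z. z \<noteq> 0 \<longrightarrow> \<phi> z = c * cnj z) \<or> (\<forall>z. z \<noteq> 0 \<longrightarrow> \<phi> z = c / cnj z)"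
proof -
  define c where "c = \<phi> 1"
  have c: "c \<noteq> 0" unfolding c_def by (rule nonzero) simp
  define \<psi> where "\<psi> = (\<lambda>z. \<phi> z / c)"
  have \<phi>_eq: "\<phi> z = c * \<psi> z" for z using c by (simp add: \<psi>_def)
  have "punctured_conjugation \<psi>"
    unfolding \<psi>_def by (rule compose_automorphism[where \<beta> = "\<lambda>z. z * c"])
      (use c in \<open>auto intro!: holomorphic_intros\<close>)
  then interpret \<psi>: punctured_conjugation \<psi> .
  interpret \<psi>: multiplicative_punctured_conjugation \<psi>
  proof
    show "\<psi> (x * y) = \<psi> x * \<psi> y" if "x \<noteq> 0" "y \<noteq> 0" for x y
      using mult_unnormalized[OF that] c by (simp add: \<psi>_def c_def field_simps)
  qed
  show thesis
  proof (cases "norm (\<psi> 2) > 1")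
    case True
    from \<psi>.identity_or_cnj[OF this] c \<phi>_eq that[of c] show thesis by auto
  next
    case False
    have "punctured_conjugation (\<lambda>z. inverse (\<psi> z))"
      by (rule \<psi>.compose_automorphism[where \<beta> = inverse])
        (use holomorphic_compose_inverse[OF holomorphic_on_ident] in auto)
    then interpret \<rho>: punctured_conjugation "\<lambda>z. inverse (\<psi> z)" .
    interpret \<rho>: multiplicative_punctured_conjugation "\<lambda>z. inverse (\<psi> z)"
      by unfold_locales (simp add: \<psi>.mult)
    have "norm (\<psi> 2) < 1" "\<psi> 2 \<noteq> 0"
      using False \<psi>.norm_2_neq_1 \<psi>.nonzero[of 2] by auto
    then have "norm (inverse (\<psi> 2)) > 1"
      by (simp add: norm_inverse one_less_inverse)
    from \<rho>.identity_or_cnj[OF this] have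
      "(\<forall>z. z \<noteq> 0 \<longrightarrow> \<psi> z = inverse z) \<or> (\<forall>z. z \<noteq> 0 \<longrightarrow> \<psi> z = inverse (cnj z))"
      by (metis inverse_inverse_eq)
    with c \<phi>_eq that[of c] show thesis by (auto simp: divide_inverse)
  qed
qed

section \<open>Transfer between the set-theoretic definitions and the explicit forms\<close>

lemma conjugating_map_imp_punctured_conjugation:
  assumes "conjugating_map \<phi> punctured_plane punctured_plane"
  shows "punctured_conjugation \<phi>"
proof
  have P: "punctured_plane = -{0}" by (auto simp: punctured_plane_def)
  show bij: "bij_betw \<phi> (-{0}) (-{0})"
    using assms by (simp add: conjugating_map_def P)
  fix f assume f: "f holomorphic_on -{0}" "\<And>z. z \<noteq> 0 \<Longrightarrow> f z \<noteq> 0"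
  let ?g = "\<phi> \<circ> f \<circ> inv_into (-{0}) \<phi>"
  have "f ` (-{0}) \<subseteq> -{0}"
    using f(2) by force
  then have "f \<in> holomorphic_End (-{0})"
    using f(1) by (simp add: holomorphic_End_def)
  then have "?g \<in> holomorphic_End (-{0})"
    using assms unfolding conjugating_map_def P by blast
  then have "?g holomorphic_on -{0}" "\<And>z. z \<noteq> 0 \<Longrightarrow> ?g z \<noteq> 0"
    unfolding holomorphic_End_def image_subset_iff by simp_all
  moreover have "?g (\<phi> z) = \<phi> (f z)" if "z \<noteq> 0" for z
    using bij_betw_inv_into_left[OF bij, of z] that by simp
  ultimately show "\<exists>g. g holomorphic_on -{0} \<and>
      (\<forall>z. z \<noteq> 0 \<longrightarrow> g z \<noteq> 0 \<and> g (\<phi> z) = \<phi> (f z))"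
    by blast
qed

text \<open>A left inverse \<open>k\<close> on \<open>X\<close> agrees with
  \<open>inv_into X f\<close> on \<open>Y\<close> because \<open>f\<close> is onto
  \<open>Y\<close>.\<close>

lemma biholomorphic_mapI:
  assumes bij: "bij_betw f X Y" and hol: "h holomorphic_on X" "k holomorphic_on Y"
    and f: "\<And>z. z \<in> X \<Longrightarrow> f z = h z" and k: "\<And>z. z \<in> X \<Longrightarrow> k (f z) = z"
  shows "biholomorphic_map f X Y"
proof -
  have "inv_into X f w = k w" if "w \<in> Y" for w
    using k bij_betw_inv_into_right[OF bij that] bij_betw_apply[OF bij_betw_inv_into[OF bij] that]
    by metis
  then show ?thesis
    unfolding biholomorphic_map_def
    using bij hol f holomorphic_cong[OF refl, of X f h] holomorphic_cong[OF refl, of Y "inv_into X f" k]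
    by simp
qed

text \<open>Here \<open>h\<close> and \<open>k\<close> are the complex conjugates of
  \<open>f\<close> and of its inverse.\<close>

lemma antibiholomorphic_mapI:
  assumes bij: "bij_betw f X Y" and hol: "h holomorphic_on X" "k holomorphic_on Y"
    and f: "\<And>z. z \<in> X \<Longrightarrow> cnj (f z) = h z" and k: "\<And>z. z \<in> X \<Longrightarrow> k (f z) = cnj z"
  shows "antibiholomorphic_map f X Y"
proof -
  have "cnj (inv_into X f w) = k w" if "w \<in> Y" for w
    using k bij_betw_inv_into_right[OF bij that] bij_betw_apply[OF bij_betw_inv_into[OF bij] that]
    by metis
  then show ?thesis
    unfolding antibiholomorphic_map_def antiholomorphic_on_def
    using bij hol f holomorphic_cong[OF refl, of X "\<lambda>z. cnj (f z)" h]
      holomorphic_cong[OF refl, of Y "\<lambda>z. cnj (inv_into X f z)" k]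
    by simp
qed

theorem proposition1p3:
  fixes \<phi> :: "complex \<Rightarrow> complex"
  assumes "conjugating_map \<phi> punctured_plane punctured_plane"
  shows "biholomorphic_map \<phi> punctured_plane punctured_plane \<or>
         antibiholomorphic_map \<phi> punctured_plane punctured_plane"
proof -
  have P: "punctured_plane = -{0}" by (auto simp: punctured_plane_def)
  interpret punctured_conjugation \<phi>
    by (rule conjugating_map_imp_punctured_conjugation[OF assms])
  have lin: "(\<lambda>z. a * z) holomorphic_on -{0}" "(\<lambda>z. a / z) holomorphic_on -{0}" for a :: complex
    by (auto intro!: holomorphic_intros)
  obtain c where c: "c \<noteq> 0" and cases:
    "(\<forall>z. z \<noteq> 0 \<longrightarrow> \<phi> z = c * z) \<or> (\<forall>z. z \<noteq> 0 \<longrightarrow> \<phi> z = c / z) \<or>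
     (\<forall>z. z \<noteq> 0 \<longrightarrow> \<phi> z = c * cnj z) \<or> (\<forall>z. z \<noteq> 0 \<longrightarrow> \<phi> z = c / cnj z)"
    by (rule explicit_cases)
  from cases show ?thesis
  proof (elim disjE)
    assume "\<forall>z. z \<noteq> 0 \<longrightarrow> \<phi> z = c * z"
    then show ?thesis
      using c unfolding P by (intro disjI1 biholomorphic_mapI[OF bij lin(1)[of c] lin(1)[of "1 / c"]]) auto
  next
    \<comment> \<open>An involution, so the same formula serves as inverse.\<close>
    assume "\<forall>z. z \<noteq> 0 \<longrightarrow> \<phi> z = c / z"
    then show ?thesis
      using c unfolding P by (intro disjI1 biholomorphic_mapI[OF bij lin(2)[of c] lin(2)[of c]]) auto
  next
    assume "\<forall>z. z \<noteq> 0 \<longrightarrow> \<phi> z = c * cnj z"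
    then show ?thesis
      using c unfolding P by (intro disjI2 antibiholomorphic_mapI[OF bij lin(1)[of "cnj c"] lin(1)[of "1 / c"]]) auto
  next
    assume "\<forall>z. z \<noteq> 0 \<longrightarrow> \<phi> z = c / cnj z"
    then show ?thesis
      using c unfolding P by (intro disjI2 antibiholomorphic_mapI[OF bij lin(2)[of "cnj c"] lin(2)[of c]]) auto
  qed
qed

end
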